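(* Let $\alpha\in[0,1]$, let $\mathscr{G}$ be a connected graph of order $n\ge 2$ with vertex set $\{v_1,\dots,v_n\}$, and for each $i=1,\dots,n$ let $\mathscr{G}_i$ be an $r_i$-regular graph of order $n_i\ge 1$ with vertex set $V(\mathscr{G}_i)=\{v_{i1},\dots,v_{in_i}\}$. Let $\mathscr{H}=\mathscr{G}[\mathscr{G}_1,\dots,\mathscr{G}_n]$ be the joined union, let $d$ denote distance in $\mathscr{H}$ and $d_{\mathscr{G}}$ distance in $\mathscr{G}$. Put $$n_i'=\sum_{j=2}^{n_i}\frac{1}{d(v_{i1},v_{ij})},\qquad m_i=\sum_{t\ne i}\frac{n_t}{d_{\mathscr{G}}(v_i,v_t)} .$$ Let $\operatorname{Char}(\mathscr{G}_i,x)$ denote the characteristic polynomial of the diagonal block of $RD_\alpha(\mathscr{H})$ indexed by $V(\mathscr{G}_i)$. Then the characteristic polynomial of $RD_\alpha(\mathscr{H})$ is $$\operatorname{Char}(\mathcal{Q}^{RD_\alpha},x)\prod_{i=1}^{n}\frac{\operatorname{Char}(\mathscr{G}_i,x)}{x-\alpha\left(\frac{n_i+r_i-1}{2}+m_i\right)-(1-\alpha)n_i'},$$ where $\mathcal{Q}^{RD_\alpha}=(q_{ij})_{n\times n}$ is the quotient matrix of $RD_\alpha(\mathscr{H})$ with respect to the equitable partition $\{V(\mathscr{G}_1),\dots,V(\mathscr{G}_n)\}$, given by $$q_{ij}=\begin{cases}\alpha\left(\frac{n_i+r_i-1}{2}+m_i\right)+(1-\alpha)n_i', & i=j,\\[4pt]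 \dfrac{(1-\alpha)n_j}{d_{\mathscr{G}}(v_i,v_j)}, & i\neq j.\end{cases}$$
   Context: Graphs are finite and simple. For a connected graph $\Gamma$ with distance $d$, $RD(\Gamma)$ is the matrix indexed by $V(\Gamma)$ with $(u,v)$ entry $1/d(u,v)$ for $u\ne v$ and $0$ on the diagonal; $RT_r(\Gamma)$ is the diagonal matrix with entries $RT_r(v)=\sum_{u\ne v}1/d(v,u)$; and $RD_\alpha(\Gamma)=\alpha RT_r(\Gamma)+(1-\alpha)RD(\Gamma)$ for $\alpha\in[0,1]$ (the generalized reciprocal distance matrix). The joined union $\mathscr{G}[\mathscr{G}_1,\dots,\mathscr{G}_n]$, where $V(\mathscr{G})=\{v_1,\dots,v_n\}$, is obtained from the disjoint union of $\mathscr{G}_1,\dots,\mathscr{G}_n$ by joining every vertex of $\mathscr{G}_i$ to every vertex of $\mathscr{G}_j$ whenever $v_i\sim v_j$ in $\mathscr{G}$. The quotient matrix of a square matrix with respect to a partition of its index set has as $(i,j)$ entry the average row sum of the $(i,j)$ block; the partition is equitable if every block has constant row sums. Explicitly, the diagonal block of $RD_\alpha(\mathscr{H})$ indexed by $V(\mathscr{G}_i)$ has $(j,k)$ entry $\alpha\left(\frac{n_i+r_i-1}{2}+m_i\right)$ if $j=k$ and $\frac{1-\alpha}{d(v_{ij},v_{ik})}$ if $j\ne k$. $\operatorname{Char}(M,x)=\det(xI-M)$ for a matrix $M$. *)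

theory Defs
  imports
    "Graph_Theory.Digraph_Component"
    "Graph_Theory.Shortest_Path"
    "Jordan_Normal_Form.Char_Poly"
    "Jordan_Normal_Form.DL_Submatrix"
    "HOL-Library.Disjoint_Sets"
    "HOL-Computational_Algebra.Polynomial_Factorial"
begin

text \<open>
  A finite simple graph is a \<^locale>\<open>pair_graph\<close>: a finite, loop-free, symmetric digraph whose
  arcs are ordered pairs of vertices (an edge is the pair of its two orientations).
\<close>

text \<open>
  The shortest-path cost of the library with unit weights. Between vertices of different
  components that cost is infinite and \<^const>\<open>real_of_ereal\<close> turns it into 0, so this is the
  distance for connected graphs only.
\<close>
definition gdist :: "'a pair_pre_digraph \<Rightarrow> 'a \<Rightarrow> 'a \<Rightarrow> real" where
  "gdist G u v = real_of_ereal (wf_digraph.\<mu> (with_proj G) (\<lambda>_. 1) u v)"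

definition regular_graph :: "'a pair_pre_digraph \<Rightarrow> nat \<Rightarrow> bool" where
  "regular_graph G r \<longleftrightarrow> pair_graph G \<and> (\<forall>v\<in>pverts G. out_degree (with_proj G) v = r)"

text \<open>
  Matrices have rows and columns \<open>0, 1, \<dots>\<close>, so a matrix indexed by the vertices of a graph is
  formed along a list \<open>vs\<close> that enumerates the vertices without repetition.
\<close>

definition RD_mat :: "'a pair_pre_digraph \<Rightarrow> 'a list \<Rightarrow> real mat" where
  "RD_mat G vs = mat (length vs) (length vs)
     (\<lambda>(i, j). if i = j then 0 else 1 / gdist G (vs ! i) (vs ! j))"

definition RT :: "'a pair_pre_digraph \<Rightarrow> 'a \<Rightarrow> real" where
  "RT G v = (\<Sum>u\<in>pverts G - {v}. 1 / gdist G v u)"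

definition RT_mat :: "'a pair_pre_digraph \<Rightarrow> 'a list \<Rightarrow> real mat" where
  "RT_mat G vs = mat (length vs) (length vs) (\<lambda>(i, j). if i = j then RT G (vs ! i) else 0)"

definition RD_alpha :: "real \<Rightarrow> 'a pair_pre_digraph \<Rightarrow> 'a list \<Rightarrow> real mat" where
  "RD_alpha \<alpha> G vs = \<alpha> \<cdot>\<^sub>m RT_mat G vs + (1 - \<alpha>) \<cdot>\<^sub>m RD_mat G vs"

text \<open>
  The joined union of \<open>Gs 0, \<dots>, Gs (length vs - 1)\<close> along \<open>G\<close>, where the list \<open>vs\<close> enumerates
  the vertices of \<open>G\<close>. The vertex \<open>x\<close> of \<open>Gs i\<close> appears as the pair \<open>(i, x)\<close>, which makes the
  union disjoint.
\<close>
definition joined_union ::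
    "'a pair_pre_digraph \<Rightarrow> 'a list \<Rightarrow> (nat \<Rightarrow> 'b pair_pre_digraph) \<Rightarrow> (nat \<times> 'b) pair_pre_digraph" where
  "joined_union G vs Gs =
     \<lparr> pverts = (SIGMA i:{..<length vs}. pverts (Gs i)),
       parcs = {((i, x), (i, y)) | i x y. i < length vs \<and> (x, y) \<in> parcs (Gs i)}
             \<union> {((i, x), (j, y)) | i x j y. i < length vs \<and> j < length vs \<and>
                  (vs ! i, vs ! j) \<in> parcs G \<and> x \<in> pverts (Gs i) \<and> y \<in> pverts (Gs j)} \<rparr>"

text \<open>
  A partition of the index set \<open>{..<dim_row A}\<close> of a square matrix is given as the list of its
  parts, because the order of the parts is the order of the rows of the quotient matrix.
\<close>

definition index_partition :: "'c mat \<Rightarrow> nat set list \<Rightarrow> bool" where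
  "index_partition A Ps \<longleftrightarrow>
     square_mat A \<and> distinct Ps \<and> partition_on {..<dim_row A} (set Ps)"

definition quotient_mat :: "real mat \<Rightarrow> nat set list \<Rightarrow> real mat" where
  "quotient_mat A Ps = mat (length Ps) (length Ps)
     (\<lambda>(i, j). (\<Sum>r\<in>Ps ! i. \<Sum>s\<in>Ps ! j. A $$ (r, s)) / real (card (Ps ! i)))"

definition equitable_partition :: "real mat \<Rightarrow> nat set list \<Rightarrow> bool" where
  "equitable_partition A Ps \<longleftrightarrow> index_partition A Ps \<and>
     (\<forall>i<length Ps. \<forall>j<length Ps. \<exists>c. \<forall>r\<in>Ps ! i. (\<Sum>s\<in>Ps ! j. A $$ (r, s)) = c)"

text \<open>The positions, in the enumeration \<open>hs\<close>, of the elements of \<open>S\<close>.\<close>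
definition positions :: "'a list \<Rightarrow> 'a set \<Rightarrow> nat set" where
  "positions hs S = {k. k < length hs \<and> hs ! k \<in> S}"

end

theory Submission
  imports Defs
begin

text \<open>
  Write \<open>x I - M = D - P C\<close>, where \<open>D\<close> is the block diagonal part, \<open>P\<close> is the incidence matrix of
  indices and blocks, and \<open>C\<close> holds the constants of the off-diagonal blocks. The diagonal blocks
  of \<open>M\<close> have constant row sums \<open>s\<^sub>i\<close>, so \<open>D P = P X\<close> with \<open>X = diag (x - s\<^sub>i)\<close>. Multiplying the
  bordered matrix \<open>[[D, P], [C, I]]\<close> on the right by \<open>[[I, 0], [-C, I]]\<close> and by
  \<open>[[I, -P], [0, X]]\<close> gives \<open>det (D - P C) det X = det D det (X - C P)\<close>, an identity of polynomials
  in which \<open>X - C P = x I - Q\<close>.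

  The off-diagonal blocks are constant because a shortest walk between different blocks projects
  to \<open>G\<close> and every nonempty walk of \<open>G\<close> lifts, and the diagonal blocks have constant row sums
  because nonadjacent vertices of one \<open>Gs i\<close> have distance 2 through a neighbouring block.
\<close>

section \<open>Determinants of matrices with blocks\<close>

text \<open>Labelling rows and columns by a list turns reordering and splitting of the index set
  into list operations.\<close>

definition list_mat :: "('a \<Rightarrow> 'a \<Rightarrow> 'b) \<Rightarrow> 'a list \<Rightarrow> 'b mat" where
  "list_mat f xs = mat (length xs) (length xs) (\<lambda>(i, j). f (xs ! i) (xs ! j))"

lemma list_mat_carrier [simp]: "list_mat f xs \<in> carrier_mat (length xs) (length xs)"
  by (simp add: list_mat_def)

text \<open>A change of enumeration applies one permutation to rows and columns alike, so its sign
  enters twice and cancels.\<close>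

lemma det_list_mat_mset_cong:
  fixes f :: "'a \<Rightarrow> 'a \<Rightarrow> 'b::comm_ring_1"
  assumes "mset xs = mset ys"
  shows "det (list_mat f xs) = det (list_mat f ys)"
proof -
  obtain p where p: "p permutes {..<length ys}" and xs: "xs = permute_list p ys"
    using mset_eq_permutation[OF assms] by metis
  define n where "n = length ys"
  have p': "p permutes {0..<n}" using p by (simp add: n_def atLeast0LessThan)
  have pn: "p i < n" if "i < n" for i
    using that permutes_in_image[OF p'] by auto
  define B where "B = mat n n (\<lambda>(i, j). list_mat f ys $$ (p i, j))"
  have B: "B \<in> carrier_mat n n" by (simp add: B_def)
  \<comment> \<open>Transposition turns the column permutation into a row permutation, so that
    \<open>det_permute_rows\<close> handles both.\<close>
  have "list_mat f xs = transpose_mat (mat n n (\<lambda>(i, j). transpose_mat B $$ (p i, j)))"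
    using pn p by (auto intro!: eq_matI simp: xs list_mat_def B_def permute_list_nth n_def)
  then have "det (list_mat f xs) = det (mat n n (\<lambda>(i, j). transpose_mat B $$ (p i, j)))"
    by (simp add: det_transpose[of _ n])
  also have "\<dots> = signof p * det (transpose_mat B)"
    using B by (intro det_permute_rows[OF _ p']) simp
  also have "\<dots> = signof p * (signof p * det (list_mat f ys))"
    using det_permute_rows[OF _ p', of "list_mat f ys"] B
    by (simp add: det_transpose[of _ n] B_def n_def)
  also have "\<dots> = det (list_mat f ys)"
    by (simp add: sign_def)
  finally show ?thesis .
qed

lemma det_list_mat_append:
  fixes f :: "'a \<Rightarrow> 'a \<Rightarrow> 'b::idom"
  assumes "\<And>x y. x \<in> set xs \<Longrightarrow> y \<in> set ys \<Longrightarrow> f x y = 0"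
  shows "det (list_mat f (xs @ ys)) = det (list_mat f xs) * det (list_mat f ys)"
proof -
  let ?C = "mat (length ys) (length xs) (\<lambda>(i, j). f (ys ! i) (xs ! j))"
  have "list_mat f (xs @ ys)
      = four_block_mat (list_mat f xs) (0\<^sub>m (length xs) (length ys)) ?C (list_mat f ys)"
    using assms by (auto intro!: eq_matI simp: list_mat_def nth_append)
  then show ?thesis
    by (simp add: det_four_block_mat_upper_right_zero[of _ "length xs" _ "length ys"])
qed

text \<open>Induction on the number of classes: the labels of class \<open>n\<close> are moved
  behind those of smaller class, which keeps the determinant, and then form the last block of a
  block triangular matrix.\<close>

lemma det_list_mat_blocks:
  fixes f :: "'a \<Rightarrow> 'a \<Rightarrow> 'b::idom" and c :: "'a \<Rightarrow> nat"
  assumes "\<And>x y. x \<in> set xs \<Longrightarrow> y \<in> set xs \<Longrightarrow> c x \<noteq> c y \<Longrightarrow> f x y = 0"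
  shows "det (list_mat f (filter (\<lambda>x. c x < n) xs))
    = (\<Prod>i<n. det (list_mat f (filter (\<lambda>x. c x = i) xs)))"
proof (induction n)
  case 0
  show ?case by (simp add: list_mat_def)
next
  case (Suc n)
  have "filter (\<lambda>x. c x < n) (filter (\<lambda>x. c x < Suc n) xs) = filter (\<lambda>x. c x < n) xs"
    "filter (\<lambda>x. \<not> c x < n) (filter (\<lambda>x. c x < Suc n) xs) = filter (\<lambda>x. c x = n) xs"
    by (auto intro: filter_cong)
  then have "mset (filter (\<lambda>x. c x < Suc n) xs)
      = mset (filter (\<lambda>x. c x < n) xs @ filter (\<lambda>x. c x = n) xs)"
    by (metis mset_append mset_filter multiset_partition)
  then have "det (list_mat f (filter (\<lambda>x. c x < Suc n) xs))
      = det (list_mat f (filter (\<lambda>x. c x < n) xs @ filter (\<lambda>x. c x = n) xs))"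
    by (rule det_list_mat_mset_cong)
  also have "\<dots> = det (list_mat f (filter (\<lambda>x. c x < n) xs)) * det (list_mat f (filter (\<lambda>x. c x = n) xs))"
    by (rule det_list_mat_append) (use assms in auto)
  finally show ?case using Suc by simp
qed

text \<open>Both \<open>submatrix\<close> and filtering of \<open>[0..<N]\<close> keep the chosen
  indices in increasing order.\<close>

lemma submatrix_eq_list_mat:
  assumes "A \<in> carrier_mat N N"
  shows "submatrix A S S = list_mat (\<lambda>k l. A $$ (k, l)) (filter (\<lambda>k. k \<in> S) [0..<N])"
proof -
  have f: "filter (\<lambda>k. k \<in> S) [0..<N] = nths [0..<N] S"
    by (induction N) (auto simp: nths_append)
  show ?thesis
    using assms unfolding f
    by (intro eq_matI) (auto simp: submatrix_def list_mat_def length_nths nth_nths pick_le)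
qed

text \<open>The partition is given by a class map \<open>c\<close>, so the classes may be scattered
  over the index set; an empty class contributes the empty determinant 1.\<close>

lemma det_block_diagonal:
  fixes A :: "'b::idom mat" and c :: "nat \<Rightarrow> nat"
  assumes A: "A \<in> carrier_mat N N"
    and c: "\<And>k. k < N \<Longrightarrow> c k < n"
    and zero: "\<And>k l. k < N \<Longrightarrow> l < N \<Longrightarrow> c k \<noteq> c l \<Longrightarrow> A $$ (k, l) = 0"
  shows "det A = (\<Prod>i<n. det (submatrix A {k. k < N \<and> c k = i} {k. k < N \<and> c k = i}))"
proof -
  have "A = list_mat (\<lambda>k l. A $$ (k, l)) (filter (\<lambda>k. c k < n) [0..<N])"
    using A c by (subst filter_True) (auto intro!: eq_matI simp: list_mat_def)
  then have "det A = det (list_mat (\<lambda>k l. A $$ (k, l)) (filter (\<lambda>k. c k < n) [0..<N]))"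
    by simp
  also have "\<dots> = (\<Prod>i<n. det (list_mat (\<lambda>k l. A $$ (k, l)) (filter (\<lambda>k. c k = i) [0..<N])))"
    by (rule det_list_mat_blocks) (use zero in auto)
  also have "\<dots> = (\<Prod>i<n. det (submatrix A {k. k < N \<and> c k = i} {k. k < N \<and> c k = i}))"
    by (intro prod.cong refl arg_cong[of _ _ det])
      (auto simp: submatrix_eq_list_mat[OF A] intro!: arg_cong2[of _ _ _ _ list_mat] filter_cong)
  finally show ?thesis .
qed

text \<open>Formally, \<open>D * P = P * X\<close> reads D^-1 P = P X^-1, and the claim is the
  matrix determinant lemma for \<open>D - P * C\<close>. The bordered matrix gives it without
  inverses, which matrices of polynomials need not have.\<close>

lemma det_minus_mult_intertwine:
  fixes D :: "'b::idom mat"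
  assumes D: "D \<in> carrier_mat N N" and P: "P \<in> carrier_mat N n" and C: "C \<in> carrier_mat n N"
    and X: "X \<in> carrier_mat n n" and DP: "D * P = P * X"
  shows "det (D - P * C) * det X = det D * det (X - C * P)"
proof -
  define K where "K = four_block_mat D P C (1\<^sub>m n)"
  have K: "K \<in> carrier_mat (N + n) (N + n)" using D by (simp add: K_def)
  define L where "L = four_block_mat (1\<^sub>m N) (0\<^sub>m N n) (- C) (1\<^sub>m n)"
  have L: "L \<in> carrier_mat (N + n) (N + n)" by (simp add: L_def)
  define R where "R = four_block_mat (1\<^sub>m N) (- P) (0\<^sub>m n N) X"
  have R: "R \<in> carrier_mat (N + n) (N + n)" using X by (simp add: R_def)
  \<comment> \<open>The lower left block becomes \<open>C - C\<close>, so \<open>det K\<close> is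
    the determinant of \<open>D - P * C\<close>.\<close>
  have "K * L = four_block_mat (D - P * C) P (0\<^sub>m n N) (1\<^sub>m n)"
    unfolding K_def L_def
    by (subst mult_four_block_mat[OF D P C one_carrier_mat])
      (use D P C in \<open>auto intro!: cong_four_block_mat eq_matI simp: scalar_prod_def sum_negf\<close>)
  then have "det (K * L) = det (D - P * C)"
    using minus_carrier_mat[OF mult_carrier_mat[OF P C]] P
    by (simp add: det_four_block_mat_lower_left_zero[of _ N _ n])
  moreover have "det L = 1"
    unfolding L_def using C by (simp add: det_four_block_mat_upper_right_zero[of _ N _ n])
  ultimately have 1: "det K = det (D - P * C)"
    using det_mult[OF K L] by simp
  \<comment> \<open>This is the upper right block of \<open>K * R\<close>; the intertwining relation
    makes it vanish.\<close>
  have DP': "D * (- P) + P * X = 0\<^sub>m N n"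
  proof -
    have "D * (- P) = - (D * P)" using D P by simp
    then show ?thesis unfolding DP using P X by auto
  qed
  have "K * R = four_block_mat D (0\<^sub>m N n) C (X - C * P)"
    unfolding K_def R_def
    by (subst mult_four_block_mat[OF D P C one_carrier_mat])
      (use D P C X DP' in \<open>auto intro!: cong_four_block_mat simp: minus_add_uminus_mat comm_add_mat[of _ n n]\<close>)
  then have "det (K * R) = det D * det (X - C * P)"
    using D C minus_carrier_mat[OF mult_carrier_mat[OF C P]]
    by (simp add: det_four_block_mat_upper_right_zero[of _ N _ n])
  moreover have "det R = det X"
    unfolding R_def using P X by (simp add: det_four_block_mat_lower_left_zero[of _ N _ n])
  ultimately have "det K * det X = det D * det (X - C * P)"
    using det_mult[OF K R] by simp
  then show ?thesis unfolding 1 .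
qed

lemma det_diagonal_mat:
  "det (mat n n (\<lambda>(i, j). if i = j then z i else 0)) = (\<Prod>i<n. z i)"
proof -
  have "det (mat n n (\<lambda>(i, j). if i = j then z i else 0))
      = prod_list (diag_mat (mat n n (\<lambda>(i, j). if i = j then z i else 0)))"
    by (rule det_upper_triangular[of _ n]) auto
  also have "\<dots> = (\<Prod>i<n. z i)"
    by (simp add: prod_list_diag_prod atLeast0LessThan)
  finally show ?thesis .
qed

section \<open>Characteristic polynomials and block row sums\<close>

lemma char_poly_matrix_index:
  assumes "M \<in> carrier_mat N N" "k < N" "l < N"
  shows "char_poly_matrix M $$ (k, l) = (if k = l then [:0, 1:] else 0) - [:M $$ (k, l):]"
  using assms by (auto simp: char_poly_matrix_def)

text \<open>Rows and columns are selected by the same set, so diagonal entries stay on the diagonal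
  and \<open>x I\<close> restricts to \<open>x I\<close>.\<close>

lemma char_poly_matrix_submatrix:
  assumes M: "M \<in> carrier_mat N N"
  shows "char_poly_matrix (submatrix M S S) = submatrix (char_poly_matrix M) S S"
proof -
  let ?ks = "filter (\<lambda>k. k \<in> S) [0..<N]"
  have lt: "?ks ! i < N" if "i < length ?ks" for i
    using nth_mem[OF that] by auto
  show ?thesis
    unfolding submatrix_eq_list_mat[OF M] submatrix_eq_list_mat[OF char_poly_matrix_closed[OF M]]
    by (intro eq_matI)
      (auto simp: char_poly_matrix_index[OF mat_carrier]
        carrier_matD[OF char_poly_matrix_closed[OF mat_carrier]] char_poly_matrix_index[OF M] lt
        list_mat_def nth_eq_iff_index_eq)
qed

text \<open>The denominators of the target formula are multiplied out, which keeps the identity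
  inside the polynomial ring.\<close>

lemma char_poly_times_prod_row_sums:
  fixes M :: "'b::idom mat" and c :: "nat \<Rightarrow> nat"
  assumes M: "M \<in> carrier_mat N N"
    and c: "\<And>k. k < N \<Longrightarrow> c k < n"
    and diag: "\<And>k. k < N \<Longrightarrow> (\<Sum>l | l < N \<and> c l = c k. M $$ (k, l)) = s (c k)"
    and off: "\<And>k l. k < N \<Longrightarrow> l < N \<Longrightarrow> c k \<noteq> c l \<Longrightarrow> M $$ (k, l) = b (c k) (c l)"
  shows "char_poly M * (\<Prod>i<n. [:- s i, 1:])
    = char_poly (mat n n (\<lambda>(i, j). if i = j then s i else b i j * of_nat (card {l. l < N \<and> c l = j})))
      * (\<Prod>i<n. char_poly (submatrix M {k. k < N \<and> c k = i} {k. k < N \<and> c k = i}))"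
proof -
  let ?A = "char_poly_matrix M"
  let ?Q = "mat n n (\<lambda>(i, j). if i = j then s i else b i j * of_nat (card {l. l < N \<and> c l = j}))"
  let ?S = "\<lambda>i. {k. k < N \<and> c k = i}"
  define D where "D = mat N N (\<lambda>(k, l). if c k = c l then ?A $$ (k, l) else 0)"
  define P :: "'b poly mat" where "P = mat N n (\<lambda>(k, i). if c k = i then 1 else 0)"
  \<comment> \<open>Outside the diagonal blocks \<open>x I - M\<close> has the entries
    \<open>- b\<close>; \<open>D - P * C\<close> supplies the sign, so \<open>C\<close> carries
    \<open>b\<close> itself.\<close>
  define C where "C = mat n N (\<lambda>(i, l). if c l = i then 0 else [:b i (c l):])"
  define X where "X = mat n n (\<lambda>(i, j). if i = j then [:- s i, 1:] else 0)"
  have A: "?A \<in> carrier_mat N N" using M by simp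
  have carr: "D \<in> carrier_mat N N" "P \<in> carrier_mat N n" "C \<in> carrier_mat n N" "X \<in> carrier_mat n n"
    by (simp_all add: D_def P_def C_def X_def)
  \<comment> \<open>Row \<open>k\<close> of \<open>P\<close> is the unit vector at
    \<open>c k\<close>, so row \<open>k\<close> of \<open>P * Y\<close> repeats row
    \<open>c k\<close> of \<open>Y\<close>.\<close>
  have PY: "(P * Y) $$ (k, j) = Y $$ (c k, j)" if Y: "Y \<in> carrier_mat n m" and kj: "k < N" "j < m" for Y m k j
  proof -
    have "(P * Y) $$ (k, j) = (\<Sum>i<n. P $$ (k, i) * Y $$ (i, j))"
      using Y kj carr by (simp add: scalar_prod_def atLeast0LessThan)
    also have "\<dots> = (\<Sum>i<n. if c k = i then Y $$ (i, j) else 0)"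
      using kj by (intro sum.cong) (auto simp: P_def)
    finally show ?thesis using c[OF kj(1)] by simp
  qed
  have "(D * P) $$ (k, i) = (P * X) $$ (k, i)" if ki: "k < N" "i < n" for k i
  proof -
    have "(D * P) $$ (k, i) = (\<Sum>l<N. if c l = i then D $$ (k, l) else 0)"
      using ki by (auto simp: D_def P_def scalar_prod_def atLeast0LessThan intro!: sum.cong)
    also have "\<dots> = (\<Sum>l | l < N \<and> c l = i. D $$ (k, l))"
      by (simp add: sum.If_cases Collect_conj_eq lessThan_def)
    \<comment> \<open>Row \<open>k\<close> of \<open>D\<close> vanishes outside its own block;
      inside it the variable occurs once, at \<open>l = k\<close>, and the constants add up to the
      row sum.\<close>
    also have "\<dots> = (if c k = i then \<Sum>l | l < N \<and> c l = i. (if k = l then [:0, 1:] else 0) - [:M $$ (k, l):] else 0)"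
      using ki by (auto simp: D_def char_poly_matrix_index[OF M] intro!: sum.cong sum.neutral)
    also have "\<dots> = (if c k = i then [:- s i, 1:] else 0)"
      using ki diag[OF ki(1)]
      by (auto simp: sum_subtractf sum_to_poly sum.delta)
    also have "\<dots> = X $$ (c k, i)"
      using ki c by (simp add: X_def)
    also have "\<dots> = (P * X) $$ (k, i)"
      using PY[OF carr(4) ki] by simp
    finally show ?thesis .
  qed
  then have DP: "D * P = P * X" using carr by (intro eq_matI) auto
  have PC: "(P * C) $$ (k, l) = (if c l = c k then 0 else [:b (c k) (c l):])"
    if "k < N" "l < N" for k l
    using PY[OF carr(3) that] c that by (simp add: C_def)
  have "D - P * C = ?A"
  proof (rule eq_matI)
    fix k l assume "k < dim_row ?A" "l < dim_col ?A"
    then have "k < N" "l < N" using A by auto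
    moreover from this have "(D - P * C) $$ (k, l) = D $$ (k, l) - (P * C) $$ (k, l)"
      using carr by simp
    ultimately show "(D - P * C) $$ (k, l) = ?A $$ (k, l)"
      using off by (auto simp only: PC) (auto simp: D_def char_poly_matrix_index[OF M])
  qed (use carr A in auto)
  moreover have "X - C * P = char_poly_matrix ?Q"
  proof (rule eq_matI)
    fix i j assume "i < dim_row (char_poly_matrix ?Q)" "j < dim_col (char_poly_matrix ?Q)"
    then have ij: "i < n" "j < n" by (auto simp: char_poly_matrix_def)
    \<comment> \<open>Column \<open>j\<close> of \<open>P\<close> selects the indices of block
      \<open>j\<close>, whence the factor \<open>card\<close>.\<close>
    have "(C * P) $$ (i, j) = (\<Sum>l<N. if c l = j then C $$ (i, l) else 0)"
      using ij by (auto simp: C_def P_def scalar_prod_def atLeast0LessThan intro!: sum.cong)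
    also have "\<dots> = (\<Sum>l | l < N \<and> c l = j. C $$ (i, l))"
      by (simp add: sum.If_cases Collect_conj_eq lessThan_def)
    also have "\<dots> = (\<Sum>l | l < N \<and> c l = j. if i = j then 0 else [:b i j:])"
      using ij by (auto simp: C_def intro!: sum.cong)
    also have "\<dots> = (if i = j then 0 else [:b i j * of_nat (card {l. l < N \<and> c l = j}):])"
      by (simp add: of_nat_poly mult.commute)
    finally show "(X - C * P) $$ (i, j) = char_poly_matrix ?Q $$ (i, j)"
      using ij carr by (auto simp: X_def char_poly_matrix_index[of _ n])
  qed (use carr in \<open>auto simp: char_poly_matrix_def\<close>)
  moreover have "det X = (\<Prod>i<n. [:- s i, 1:])"
    unfolding X_def by (rule det_diagonal_mat)
  moreover have "det D = (\<Prod>i<n. char_poly (submatrix M (?S i) (?S i)))"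
  proof -
    have "submatrix D (?S i) (?S i) = submatrix ?A (?S i) (?S i)" for i
      using carr A pick_in_set_le[of _ "?S i"]
      by (intro eq_matI) (auto simp: submatrix_def D_def)
    moreover have "det D = (\<Prod>i<n. det (submatrix D (?S i) (?S i)))"
      by (rule det_block_diagonal) (use carr c in \<open>auto simp: D_def\<close>)
    ultimately show ?thesis
      by (simp add: char_poly_def char_poly_matrix_submatrix[OF M])
  qed
  ultimately show ?thesis
    using det_minus_mult_intertwine[OF carr DP] by (simp add: char_poly_def mult.commute)
qed

section \<open>Distances in the joined union\<close>

text \<open>Relation powers make projection and lifting of walks inductions on the exponent. The
  vertex condition matters for exponent 0, where the power is the identity on the whole type but the
  empty walk needs a vertex.\<close>

lemma (in pair_wf_digraph) awalk_iff_relpow: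
  "(\<exists>p. awalk u p v \<and> length p = k) \<longleftrightarrow> u \<in> pverts G \<and> (u, v) \<in> parcs G ^^ k"
proof (induction k arbitrary: u)
  case 0
  show ?case by (auto simp: awalk_Nil_iff)
next
  case (Suc k)
  have "(\<exists>p. awalk u p v \<and> length p = Suc k)
      \<longleftrightarrow> (\<exists>w. (u, w) \<in> parcs G \<and> (\<exists>p. awalk w p v \<and> length p = k))"
  proof
    assume "\<exists>p. awalk u p v \<and> length p = Suc k"
    then show "\<exists>w. (u, w) \<in> parcs G \<and> (\<exists>p. awalk w p v \<and> length p = k)"
      by (fastforce simp: length_Suc_conv awalk_Cons_iff)
  next
    assume "\<exists>w. (u, w) \<in> parcs G \<and> (\<exists>p. awalk w p v \<and> length p = k)"
    then obtain w p where "(u, w) \<in> parcs G" "awalk w p v" "length p = k" by blast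
    then show "\<exists>p. awalk u p v \<and> length p = Suc k"
      by (intro exI[of _ "(u, w) # p"]) (simp add: awalk_Cons_iff)
  qed
  moreover have "(u, v) \<in> parcs G ^^ Suc k \<longleftrightarrow> (\<exists>w. (u, w) \<in> parcs G \<and> (w, v) \<in> parcs G ^^ k)"
    by (metis relpow_Suc_D2 relpow_Suc_I2)
  ultimately show ?case
    unfolding Suc.IH using in_arcsD1 in_arcsD2 by blast
qed

lemma (in wf_digraph) awalk_cost_1: "awalk_cost (\<lambda>_. 1) p = real (length p)"
  by (induction p) simp_all

text \<open>A walk of length \<open>k\<close> attains the infimum in \<open>\<mu>\<close>, so the
  cost is finite and \<open>real_of_ereal\<close> is harmless.\<close>

lemma gdist_eqI:
  assumes "pair_wf_digraph G" "u \<in> pverts G" "(u, v) \<in> parcs G ^^ k"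
    and least: "\<And>l. (u, v) \<in> parcs G ^^ l \<Longrightarrow> k \<le> l"
  shows "gdist G u v = real k"
proof -
  interpret pair_wf_digraph G by fact
  have "\<mu> (\<lambda>_. 1) u v = ereal (real k)"
    unfolding \<mu>_def
  proof (rule INF_eqI)
    fix p assume "p \<in> {p. awalk u p v}"
    then show "ereal (real k) \<le> ereal (awalk_cost (\<lambda>_. 1) p)"
      using least awalk_iff_relpow[of u v "length p"] by (auto simp: awalk_cost_1)
  next
    fix y assume y: "\<And>p. p \<in> {p. awalk u p v} \<Longrightarrow> y \<le> ereal (awalk_cost (\<lambda>_. 1) p)"
    obtain p where "awalk u p v" "length p = k"
      using assms awalk_iff_relpow[of u v k] by auto
    then show "y \<le> ereal (real k)" using y[of p] by (auto simp: awalk_cost_1)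
  qed
  then show ?thesis by (simp add: gdist_def)
qed

text \<open>\<open>connected\<close> speaks of the symmetric closure; as the arcs are symmetric
  already, it yields directed walks.\<close>

lemma connected_relpow:
  assumes "pair_graph G" "Digraph_Component.connected (with_proj G)" "u \<in> pverts G" "v \<in> pverts G"
  shows "\<exists>k. (u, v) \<in> parcs G ^^ k"
proof -
  interpret pair_graph G by fact
  have "strongly_connected (with_proj G)"
    using symmetric_connected_imp_strongly_connected[OF _ assms(2)] sym_arcs by blast
  then have "u \<rightarrow>\<^sup>*\<^bsub>with_proj G\<^esub> v"
    using assms by (auto simp: strongly_connected_def)
  then obtain p where "awalk u p v" using reachable_awalk by auto
  then show ?thesis using awalk_iff_relpow[of u v "length p"] by auto
qed

text \<open>The first step of a walk to some other vertex gives \<open>w\<close>. The two arcs form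
  the closed walk behind the distance 2 in \<open>gdist_H_same\<close>.\<close>

lemma connected_neighbour:
  assumes "pair_graph G" "Digraph_Component.connected (with_proj G)"
    and u: "u \<in> pverts G" and "card (pverts G) \<ge> 2"
  shows "\<exists>w. (u, w) \<in> parcs G \<and> (w, u) \<in> parcs G"
proof -
  interpret pair_graph G by fact
  have "pverts G \<noteq> {u}" using assms by auto
  then obtain v where v: "v \<in> pverts G" "v \<noteq> u" using u by auto
  then obtain k where k: "(u, v) \<in> parcs G ^^ k" using connected_relpow assms by metis
  then have "k \<noteq> 0" using v by (cases k) auto
  then obtain w where "(u, w) \<in> parcs G" using k by (metis not0_implies_Suc relpow_Suc_D2)
  then show ?thesis using arcs_symmetric by blast
qed

text \<open>Nonempty factors let walks of \<open>G\<close> lift to \<open>H\<close>. Regularity is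
  left to the lemmas that sum over a factor.\<close>

locale joined_union_graph =
  fixes G :: "'a pair_pre_digraph" and vs :: "'a list" and Gs :: "nat \<Rightarrow> 'b pair_pre_digraph"
    and n :: nat and H :: "(nat \<times> 'b) pair_pre_digraph"
  assumes graph_G: "pair_graph G" and connected_G: "Digraph_Component.connected (with_proj G)"
    and n: "n \<ge> 2" and vs: "distinct vs" "set vs = pverts G" "length vs = n"
    and graph_Gs: "\<And>i. i < n \<Longrightarrow> pair_graph (Gs i)"
    and Gs_nonempty: "\<And>i. i < n \<Longrightarrow> pverts (Gs i) \<noteq> {}"
    and H: "H = joined_union G vs Gs"
begin

lemma nth_vs [simp]: "i < n \<Longrightarrow> vs ! i \<in> pverts G"
  using vs by auto

lemma pverts_H: "pverts H = (SIGMA i:{..<n}. pverts (Gs i))"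
  using vs by (simp add: H joined_union_def)

lemma parcs_H_iff: "((i, x), (j, y)) \<in> parcs H \<longleftrightarrow>
    i < n \<and> j < n \<and> x \<in> pverts (Gs i) \<and> y \<in> pverts (Gs j) \<and>
    (i = j \<and> (x, y) \<in> parcs (Gs i) \<or> (vs ! i, vs ! j) \<in> parcs G)"
proof -
  have "x \<in> pverts (Gs i) \<and> y \<in> pverts (Gs i)" if "i < n" "(x, y) \<in> parcs (Gs i)"
  proof -
    interpret pair_graph "Gs i" using that graph_Gs by blast
    show ?thesis using that in_arcsD1 in_arcsD2 by blast
  qed
  then show ?thesis using vs by (auto simp: H joined_union_def)
qed

lemma wf_H: "pair_wf_digraph H"
  by unfold_locales (auto simp: pverts_H parcs_H_iff)

text \<open>An arc inside a factor projects to no step at all, so the length can only drop.\<close>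

lemma relpow_H_project:
  assumes "((i, x), (j, y)) \<in> parcs H ^^ l"
  shows "\<exists>l'\<le>l. (vs ! i, vs ! j) \<in> parcs G ^^ l'"
  using assms
proof (induction l arbitrary: j y)
  case 0
  then show ?case by auto
next
  case (Suc l)
  then obtain t z where tz: "((i, x), (t, z)) \<in> parcs H ^^ l" "((t, z), (j, y)) \<in> parcs H"
    by auto
  then obtain l' where l': "l' \<le> l" "(vs ! i, vs ! t) \<in> parcs G ^^ l'"
    using Suc.IH by blast
  show ?case
  proof (cases "t = j")
    case True
    then show ?thesis using l' by (metis le_SucI)
  next
    case False
    then have "(vs ! t, vs ! j) \<in> parcs G" using tz by (auto simp: parcs_H_iff)
    then have "(vs ! i, vs ! j) \<in> parcs G ^^ Suc l'" using l' by auto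
    then show ?thesis using l' by (metis Suc_le_mono)
  qed
qed

text \<open>Arcs of \<open>G\<close> become complete joins, so inner vertices may be lifted
  arbitrarily and both ends prescribed. The exponent \<open>Suc k\<close> excludes the empty walk,
  which would force \<open>x = y\<close> when \<open>i = j\<close>.\<close>

lemma relpow_H_lift:
  assumes "(vs ! i, vs ! j) \<in> parcs G ^^ Suc k" "i < n" "j < n" "x \<in> pverts (Gs i)" "y \<in> pverts (Gs j)"
  shows "((i, x), (j, y)) \<in> parcs H ^^ Suc k"
  using assms
proof (induction k arbitrary: j y)
  case 0
  then show ?case by (auto simp: parcs_H_iff)
next
  case (Suc k)
  then obtain w where w: "(vs ! i, w) \<in> parcs G ^^ Suc k" "(w, vs ! j) \<in> parcs G"
    by (metis relpow_Suc_E)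
  interpret pair_graph G by (rule graph_G)
  have "w \<in> pverts G" using w(2) by (rule in_arcsD1)
  then obtain t where t: "t < n" "w = vs ! t" using vs by (metis in_set_conv_nth)
  obtain z where z: "z \<in> pverts (Gs t)" using Gs_nonempty t by blast
  have "((i, x), (t, z)) \<in> parcs H ^^ Suc k" using Suc t w z by blast
  moreover have "((t, z), (j, y)) \<in> parcs H" using Suc t w z by (auto simp: parcs_H_iff)
  ultimately show ?case by (rule relpow_Suc_I)
qed

text \<open>Lifting a shortest walk bounds the distance from above, projection bounds it from
  below.\<close>

lemma gdist_H_different:
  assumes "i < n" "j < n" "i \<noteq> j" "x \<in> pverts (Gs i)" "y \<in> pverts (Gs j)"
  shows "gdist H (i, x) (j, y) = gdist G (vs ! i) (vs ! j)"
proof -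
  interpret pair_graph G by (rule graph_G)
  let ?k = "LEAST k. (vs ! i, vs ! j) \<in> parcs G ^^ k"
  have ex: "\<exists>k. (vs ! i, vs ! j) \<in> parcs G ^^ k"
    using connected_relpow[OF graph_G connected_G] assms by simp
  then have k: "(vs ! i, vs ! j) \<in> parcs G ^^ ?k" by (rule LeastI_ex)
  have least: "?k \<le> l" if "(vs ! i, vs ! j) \<in> parcs G ^^ l" for l
    using that by (rule Least_le)
  \<comment> \<open>Lifting needs a positive length, which distinct ends guarantee.\<close>
  have "vs ! i \<noteq> vs ! j" using assms vs by (simp add: nth_eq_iff_index_eq)
  then obtain k' where k': "?k = Suc k'" using k by (cases ?k) auto
  have "gdist G (vs ! i) (vs ! j) = real ?k"
    by (rule gdist_eqI) (use k least assms pair_wf_digraph in auto)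
  moreover have "gdist H (i, x) (j, y) = real ?k"
  proof (rule gdist_eqI[OF wf_H])
    show "((i, x), (j, y)) \<in> parcs H ^^ ?k"
      using relpow_H_lift k assms unfolding k' by blast
  next
    fix l assume "((i, x), (j, y)) \<in> parcs H ^^ l"
    then show "?k \<le> l" using relpow_H_project least by (meson le_trans)
  qed (use assms in \<open>auto simp: pverts_H\<close>)
  ultimately show ?thesis by simp
qed

lemma gdist_H_same:
  assumes i: "i < n" and xy: "x \<noteq> y" "x \<in> pverts (Gs i)" "y \<in> pverts (Gs i)"
  shows "gdist H (i, x) (i, y) = (if (x, y) \<in> parcs (Gs i) then 1 else 2)"
proof -
  interpret pair_graph G by (rule graph_G)
  \<comment> \<open>Without loops in \<open>G\<close>, arcs between vertices of one factor come from
    that factor alone.\<close>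
  have no_loop: "(vs ! i, vs ! i) \<notin> parcs G" using no_loops' by blast
  have arc: "((i, x), (i, y)) \<in> parcs H \<longleftrightarrow> (x, y) \<in> parcs (Gs i)"
    using assms no_loop by (auto simp: parcs_H_iff)
  have pos: "l \<noteq> 0" if "((i, x), (i, y)) \<in> parcs H ^^ l" for l
    using that xy by (cases l) auto
  show ?thesis
  proof (cases "(x, y) \<in> parcs (Gs i)")
    case True
    have "gdist H (i, x) (i, y) = real 1"
      by (rule gdist_eqI[OF wf_H]) (use True arc pos assms in \<open>auto simp: pverts_H Suc_le_eq\<close>)
    then show ?thesis using True by simp
  next
    case False
    have "card (pverts G) \<ge> 2" using n vs distinct_card by metis
    then obtain w where "(vs ! i, w) \<in> parcs G" "(w, vs ! i) \<in> parcs G"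
      using connected_neighbour[OF graph_G connected_G] i nth_vs by blast
    \<comment> \<open>The closed walk through \<open>w\<close>, with exponent \<open>Suc 1\<close>
      as the lift requires, joins \<open>x\<close> and \<open>y\<close> through the factor at
      \<open>w\<close>.\<close>
    then have "(vs ! i, vs ! i) \<in> parcs G ^^ Suc 1" by auto
    then have two: "((i, x), (i, y)) \<in> parcs H ^^ 2"
      using relpow_H_lift assms by (metis Suc_1)
    have "l \<noteq> 1" if "((i, x), (i, y)) \<in> parcs H ^^ l" for l
      using that False arc by auto
    then have "gdist H (i, x) (i, y) = real 2"
      by (intro gdist_eqI[OF wf_H _ two])
        (use pos assms in \<open>auto simp: pverts_H numeral_2_eq_2 Suc_le_eq nat_neq_iff less_Suc_eq\<close>)
    then show ?thesis using False by simp
  qed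
qed

section \<open>Reciprocal distance sums\<close>

lemma sum_recip_gdist_block:
  assumes i: "i < n" and reg: "regular_graph (Gs i) r" and x: "x \<in> pverts (Gs i)"
  shows "(\<Sum>y\<in>pverts (Gs i) - {x}. 1 / gdist H (i, x) (i, y))
    = (real (card (pverts (Gs i))) + real r - 1) / 2"
proof -
  interpret Gi: pair_graph "Gs i" using graph_Gs i by blast
  let ?V = "pverts (Gs i)"
  let ?N = "{y. (x, y) \<in> parcs (Gs i)}"
  have fin: "finite ?V" by (rule Gi.pair_finite_verts)
  have N: "?N \<subseteq> ?V - {x}" using Gi.in_arcsD2 Gi.no_loops' by blast
  have "out_arcs (with_proj (Gs i)) x = Pair x ` ?N"
    by (auto simp: out_arcs_def)
  then have r: "card ?N = r"
    using reg x by (auto simp: regular_graph_def out_degree_def card_image inj_on_def)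
  \<comment> \<open>Every other vertex of the factor counts 1/2, and each of the \<open>r\<close>
    neighbours, at distance 1, another 1/2.\<close>
  have "(\<Sum>y\<in>?V - {x}. 1 / gdist H (i, x) (i, y))
      = (\<Sum>y\<in>?V - {x}. 1 / 2 + (if y \<in> ?N then 1 / 2 else 0))"
    using i x by (intro sum.cong) (auto simp: gdist_H_same)
  also have "\<dots> = real (card (?V - {x})) / 2 + (\<Sum>y\<in>?V - {x}. if y \<in> ?N then 1 / 2 else 0)"
    by (simp add: sum.distrib)
  also have "(\<Sum>y\<in>?V - {x}. if y \<in> ?N then 1 / 2 else 0) = (\<Sum>y\<in>?N. 1 / 2 :: real)"
    using fin N by (intro sum.mono_neutral_cong_right) auto
  also have "real (card (?V - {x})) = real (card ?V) - 1"
    using x fin card_gt_0_iff[of ?V] by (auto simp: card_Diff_singleton of_nat_diff)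
  finally show ?thesis using r by (simp add: field_simps)
qed

text \<open>The own factor is covered by \<open>sum_recip_gdist_block\<close>, the others by
  distances in \<open>G\<close>. The value is the same for all \<open>x\<close> in the factor, so
  the diagonal of \<open>RD_alpha\<close> is constant on each block.\<close>

lemma RT_H:
  assumes i: "i < n" and reg: "regular_graph (Gs i) r" and x: "x \<in> pverts (Gs i)"
  shows "RT H (i, x) = (real (card (pverts (Gs i))) + real r - 1) / 2
    + (\<Sum>t\<in>{..<n} - {i}. real (card (pverts (Gs t))) / gdist G (vs ! i) (vs ! t))"
proof -
  have fin: "finite (pverts (Gs t))" if "t < n" for t
  proof -
    interpret Gt: pair_graph "Gs t" by (rule graph_Gs[OF that])
    show ?thesis by (rule Gt.pair_finite_verts)
  qed
  have split: "pverts H - {(i, x)}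
      = Pair i ` (pverts (Gs i) - {x}) \<union> (SIGMA t:{..<n} - {i}. pverts (Gs t))"
    using i by (auto simp: pverts_H)
  have "RT H (i, x) = (\<Sum>u\<in>Pair i ` (pverts (Gs i) - {x}). 1 / gdist H (i, x) u)
      + (\<Sum>u\<in>(SIGMA t:{..<n} - {i}. pverts (Gs t)). 1 / gdist H (i, x) u)"
    unfolding RT_def split by (rule sum.union_disjoint) (use fin i in \<open>auto intro: finite_SigmaI\<close>)
  also have "(\<Sum>u\<in>Pair i ` (pverts (Gs i) - {x}). 1 / gdist H (i, x) u)
      = (real (card (pverts (Gs i))) + real r - 1) / 2"
    using sum_recip_gdist_block[OF assms] by (simp add: sum.reindex inj_on_def)
  also have "(\<Sum>u\<in>(SIGMA t:{..<n} - {i}. pverts (Gs t)). 1 / gdist H (i, x) u)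
      = (\<Sum>t\<in>{..<n} - {i}. \<Sum>y\<in>pverts (Gs t). 1 / gdist H (i, x) (t, y))"
    using fin by (subst sum.Sigma) auto
  also have "\<dots> = (\<Sum>t\<in>{..<n} - {i}. \<Sum>y\<in>pverts (Gs t). 1 / gdist G (vs ! i) (vs ! t))"
    using i x by (intro sum.cong) (auto simp: gdist_H_different)
  finally show ?thesis by simp
qed

end

section \<open>The characteristic polynomial\<close>

lemma to_fract_prod: "to_fract (prod f A) = (\<Prod>x\<in>A. to_fract (f x))"
  by (induction A rule: infinite_finite_induct) simp_all

text \<open>Division takes place in the fraction field of the real polynomials, where the monic
  linear denominators are nonzero.\<close>

theorem theorem2p1:
  fixes \<alpha> :: real
    and n :: nat
    and G :: "'a pair_pre_digraph"
    and vs :: "'a list"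
    and Gs :: "nat \<Rightarrow> 'b pair_pre_digraph"
    and ws :: "nat \<Rightarrow> 'b list"
    and ns r :: "nat \<Rightarrow> nat"
    and H :: "(nat \<times> 'b) pair_pre_digraph"
    and hs :: "(nat \<times> 'b) list"
    and n' m :: "nat \<Rightarrow> real"
    and M :: "real mat"
    and Ps :: "nat set list"
  assumes alpha: "0 \<le> \<alpha>" "\<alpha> \<le> 1"
    and G: "pair_graph G" "Digraph_Component.connected (with_proj G)"
    and n: "n \<ge> 2"
    and vs: "distinct vs" "set vs = pverts G" "length vs = n"
    and Gs: "\<And>i. i < n \<Longrightarrow> regular_graph (Gs i) (r i)"
    and ns: "\<And>i. i < n \<Longrightarrow> ns i \<ge> 1"
    and ws: "\<And>i. i < n \<Longrightarrow> distinct (ws i)" "\<And>i. i < n \<Longrightarrow> set (ws i) = pverts (Gs i)"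
      "\<And>i. i < n \<Longrightarrow> length (ws i) = ns i"
    and H: "H = joined_union G vs Gs"
    and hs: "distinct hs" "set hs = pverts H"
    and n': "n' = (\<lambda>i. \<Sum>j=1..<ns i. 1 / gdist H (i, ws i ! 0) (i, ws i ! j))"
    and m: "m = (\<lambda>i. \<Sum>t\<in>{..<n} - {i}. real (ns t) / gdist G (vs ! i) (vs ! t))"
    and M: "M = RD_alpha \<alpha> H hs"
    and Ps: "Ps = map (\<lambda>i. positions hs ({i} \<times> pverts (Gs i))) [0..<n]"
  shows "equitable_partition M Ps \<and>
    quotient_mat M Ps = mat n n (\<lambda>(i, j).
      if i = j then \<alpha> * ((real (ns i) + real (r i) - 1) / 2 + m i) + (1 - \<alpha>) * n' i
      else (1 - \<alpha>) * real (ns j) / gdist G (vs ! i) (vs ! j)) \<and>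
    to_fract (char_poly M) = to_fract (char_poly (quotient_mat M Ps)) *
      (\<Prod>i<n. to_fract (char_poly (submatrix M (Ps ! i) (Ps ! i))) /
        to_fract [:- (\<alpha> * ((real (ns i) + real (r i) - 1) / 2 + m i) + (1 - \<alpha>) * n' i), 1:])"
proof (intro conjI)
  have graph_Gs: "pair_graph (Gs i)" if "i < n" for i
    using Gs[OF that] by (simp add: regular_graph_def)
  have card_Gs: "card (pverts (Gs i)) = ns i" if "i < n" for i
    using ws[OF that] distinct_card by metis
  have nonempty: "pverts (Gs i) \<noteq> {}" if "i < n" for i
    using card_Gs[OF that] ns[OF that] by auto
  interpret joined_union_graph G vs Gs n H
    by (rule joined_union_graph.intro) (fact G n vs graph_Gs nonempty H)+

  \<comment> \<open>Index blocks of the enumerated vertices\<close>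
  define N where "N = length hs"
  \<comment> \<open>\<open>c k\<close> is the factor containing the \<open>k\<close>-th vertex. The
    order of \<open>hs\<close> is arbitrary, so the blocks need not be intervals.\<close>
  define c where "c = (\<lambda>k. fst (hs ! k))"
  define S where "S = (\<lambda>i. {k. k < N \<and> c k = i})"
  define q where "q = (\<lambda>i. \<alpha> * ((real (ns i) + real (r i) - 1) / 2 + m i) + (1 - \<alpha>) * n' i)"
  define b where "b = (\<lambda>i j. (1 - \<alpha>) / gdist G (vs ! i) (vs ! j))"
  have hs_mem: "c k < n" "snd (hs ! k) \<in> pverts (Gs (c k))" if "k < N" for k
  proof -
    have "hs ! k \<in> (SIGMA i:{..<n}. pverts (Gs i))"
      using nth_mem[of k hs] that unfolding hs(2) pverts_H N_def by blast
    then show "c k < n" "snd (hs ! k) \<in> pverts (Gs (c k))"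
      unfolding c_def by force+
  qed
  have hs_eq: "hs ! k = (c k, snd (hs ! k))" for k by (simp add: c_def)
  have S_less: "S i \<subseteq> {..<N}" for i by (auto simp: S_def)
  have Ps_nth: "Ps ! i = S i" if "i < n" for i
    using that hs_mem by (auto simp: Ps positions_def S_def N_def c_def mem_Times_iff)
  have length_Ps: "length Ps = n" by (simp add: Ps)
  have inj: "inj_on ((!) hs) (S i)" for i
    using hs(1) by (auto simp: inj_on_def S_def N_def nth_eq_iff_index_eq)
  have image: "(!) hs ` S i = Pair i ` pverts (Gs i)" if "i < n" for i
  proof
    show "(!) hs ` S i \<subseteq> Pair i ` pverts (Gs i)"
    proof (rule image_subsetI)
      fix k assume "k \<in> S i"
      then have "hs ! k = (i, snd (hs ! k))" "snd (hs ! k) \<in> pverts (Gs i)"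
        using hs_mem[of k] hs_eq[of k] by (auto simp: S_def)
      then show "hs ! k \<in> Pair i ` pverts (Gs i)" by (metis imageI)
    qed
    show "Pair i ` pverts (Gs i) \<subseteq> (!) hs ` S i"
    proof clarify
      fix y assume "y \<in> pverts (Gs i)"
      then have "(i, y) \<in> set hs" using hs(2) that by (simp add: pverts_H)
      then obtain k where "k < N" "hs ! k = (i, y)" by (auto simp: in_set_conv_nth N_def)
      then show "(i, y) \<in> (!) hs ` S i" by (force simp: S_def c_def image_iff)
    qed
  qed
  have sum_S: "(\<Sum>l\<in>S i. g (hs ! l)) = (\<Sum>y\<in>pverts (Gs i). g (i, y))"
    if "i < n" for i and g :: "nat \<times> 'b \<Rightarrow> real"
    using sum.reindex[OF inj[of i], of g] image[OF that] by (simp add: sum.reindex inj_on_def)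
  have card_S: "card (S i) = ns i" if "i < n" for i
    using card_image[OF inj[of i]] card_Gs[OF that] image[OF that] by (simp add: card_image inj_on_def)

  \<comment> \<open>Entries and row sums\<close>
  have M_carrier: "M \<in> carrier_mat N N"
    by (simp add: M RD_alpha_def RT_mat_def RD_mat_def N_def)
  have M_index: "M $$ (k, l) = (if hs ! k = hs ! l then \<alpha> * RT H (hs ! k)
      else (1 - \<alpha>) / gdist H (hs ! k) (hs ! l))" if "k < N" "l < N" for k l
    using that hs(1) by (simp add: M RD_alpha_def RT_mat_def RD_mat_def N_def nth_eq_iff_index_eq)
  have M_off: "M $$ (k, l) = b (c k) (c l)" if "k < N" "l < N" "c k \<noteq> c l" for k l
  proof -
    have "hs ! k \<noteq> hs ! l" using that(3) by (auto simp: c_def)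
    moreover have "gdist H (hs ! k) (hs ! l) = gdist G (vs ! c k) (vs ! c l)"
      using gdist_H_different[of "c k" "c l" "snd (hs ! k)" "snd (hs ! l)"] that hs_mem
      by (simp flip: hs_eq)
    ultimately show ?thesis using that by (simp add: M_index b_def)
  qed
  \<comment> \<open>\<open>n' i\<close> is measured from the first vertex of the factor, but every
    vertex gives the same value, so it can stand in every row sum.\<close>
  have n'_eq: "n' i = (real (ns i) + real (r i) - 1) / 2" if i: "i < n" for i
  proof -
    let ?x = "ws i ! 0"
    have x: "?x \<in> pverts (Gs i)" using ws[OF i] ns[OF i] by (metis Suc_le_eq One_nat_def nth_mem)
    have "bij_betw ((!) (ws i)) {..<ns i} (pverts (Gs i))"
      by (rule bij_betw_nth) (use ws[OF i] in simp_all)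
    then have "bij_betw ((!) (ws i)) ({..<ns i} - {0}) (pverts (Gs i) - {?x})"
      by (rule bij_betw_DiffI) (use x ns[OF i] in \<open>auto simp: Suc_le_eq\<close>)
    \<comment> \<open>Positions count from 0: dropping position 0 leaves the range of the sum in
      \<open>n'\<close>.\<close>
    moreover have "{..<ns i} - {0} = {1..<ns i}" by auto
    ultimately have "n' i = (\<Sum>y\<in>pverts (Gs i) - {?x}. 1 / gdist H (i, ?x) (i, y))"
      using sum.reindex_bij_betw[of "(!) (ws i)" "{1..<ns i}" _ "\<lambda>y. 1 / gdist H (i, ?x) (i, y)"]
      by (simp add: n')
    then show ?thesis using sum_recip_gdist_block[OF i Gs[OF i] x] card_Gs[OF i] by simp
  qed
  have row_diag: "(\<Sum>l\<in>S (c k). M $$ (k, l)) = q (c k)" if k: "k < N" for k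
  proof -
    define i x where "i = c k" and "x = snd (hs ! k)"
    have ix: "hs ! k = (i, x)" "i < n" "x \<in> pverts (Gs i)"
      using hs_mem[OF k] by (simp_all add: i_def x_def c_def)
    have fin: "finite (pverts (Gs i))"
      using ws(2)[OF ix(2)] by (metis List.finite_set)
    have "(\<Sum>l\<in>S i. M $$ (k, l)) = (\<Sum>l\<in>S i. if hs ! l = (i, x) then \<alpha> * RT H (i, x)
        else (1 - \<alpha>) / gdist H (i, x) (hs ! l))"
      using k S_less[of i] by (intro sum.cong) (auto simp: M_index ix)
    also have "\<dots> = (\<Sum>y\<in>pverts (Gs i). if y = x then \<alpha> * RT H (i, x)
        else (1 - \<alpha>) / gdist H (i, x) (i, y))"
      using sum_S[OF ix(2), of "\<lambda>u. if u = (i, x) then \<alpha> * RT H (i, x)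
        else (1 - \<alpha>) / gdist H (i, x) u"] by simp
    \<comment> \<open>The diagonal entry is split off; the rest is \<open>1 - \<alpha>\<close> times
      a reciprocal distance sum.\<close>
    also have "\<dots> = \<alpha> * RT H (i, x)
        + (\<Sum>y\<in>pverts (Gs i) - {x}. if y = x then \<alpha> * RT H (i, x) else (1 - \<alpha>) / gdist H (i, x) (i, y))"
      by (subst sum.remove[OF fin ix(3)]) simp
    also have "(\<Sum>y\<in>pverts (Gs i) - {x}. if y = x then \<alpha> * RT H (i, x) else (1 - \<alpha>) / gdist H (i, x) (i, y))
        = (1 - \<alpha>) * (\<Sum>y\<in>pverts (Gs i) - {x}. 1 / gdist H (i, x) (i, y))"
      unfolding sum_distrib_left by (intro sum.cong) auto
    also have "\<dots> = (1 - \<alpha>) * n' i"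
      by (simp only: sum_recip_gdist_block[OF ix(2) Gs[OF ix(2)] ix(3)] card_Gs[OF ix(2)] n'_eq[OF ix(2)])
    also have "RT H (i, x) = (real (ns i) + real (r i) - 1) / 2 + m i"
      using RT_H[OF ix(2) Gs[OF ix(2)] ix(3)] card_Gs by (simp add: m ix(2))
    finally show ?thesis by (simp add: q_def i_def)
  qed
  have row_off: "(\<Sum>l\<in>S j. M $$ (k, l)) = b (c k) j * real (ns j)" if k: "k < N" "j < n" "j \<noteq> c k" for k j
  proof -
    have "(\<Sum>l\<in>S j. M $$ (k, l)) = (\<Sum>l\<in>S j. b (c k) j)"
      using that by (intro sum.cong) (auto simp: S_def M_off)
    then show ?thesis using card_S that by simp
  qed
  have row: "(\<Sum>l\<in>S j. M $$ (k, l)) = (if i = j then q i else b i j * real (ns j))"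
    if "i < n" "j < n" "k \<in> S i" for i j k
    using that row_diag[of k] row_off[of k j] by (auto simp: S_def)
  \<comment> \<open>Nonempty blocks make disjoint parts distinct, as \<open>index_partition\<close>
    requires.\<close>
  have S_nonempty: "S i \<noteq> {}" if "i < n" for i
    using card_S[OF that] ns[OF that] by auto
  have set_Ps: "set Ps = S ` {..<n}"
    using Ps_nth length_Ps by (auto simp: set_conv_nth image_iff)

  \<comment> \<open>Equitable partition and quotient matrix\<close>
  have "index_partition M Ps"
    unfolding index_partition_def
  proof (intro conjI)
    show "square_mat M" using M_carrier by auto
    show "distinct Ps"
      unfolding distinct_conv_nth length_Ps
    proof (intro allI impI)
      fix i j assume "i < n" "j < n" "i \<noteq> j"
      then show "Ps ! i \<noteq> Ps ! j"
        using S_nonempty[of i] Ps_nth by (auto simp: S_def)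
    qed
    have "partition_on {..<N} (S ` {..<n})"
    proof (rule partition_onI)
      show "\<Union> (S ` {..<n}) = {..<N}" using hs_mem by (auto simp: S_def)
    next
      fix p p' assume "p \<in> S ` {..<n}" "p' \<in> S ` {..<n}" "p \<noteq> p'"
      then show "disjnt p p'" by (auto simp: S_def disjnt_def)
    qed (use S_nonempty in auto)
    then show "partition_on {..<dim_row M} (set Ps)" using M_carrier set_Ps by simp
  qed
  moreover have "\<forall>i<n. \<forall>j<n. \<exists>c. \<forall>k\<in>Ps ! i. (\<Sum>l\<in>Ps ! j. M $$ (k, l)) = c"
  proof (intro allI impI)
    fix i j assume "i < n" "j < n"
    then show "\<exists>c. \<forall>k\<in>Ps ! i. (\<Sum>l\<in>Ps ! j. M $$ (k, l)) = c"
      using row[of i j] Ps_nth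
      by (intro exI[of _ "if i = j then q i else b i j * real (ns j)"]) simp
  qed
  ultimately show "equitable_partition M Ps"
    by (simp add: equitable_partition_def length_Ps)
  let ?Q = "mat n n (\<lambda>(i, j). if i = j then q i else b i j * real (ns j))"
  have "quotient_mat M Ps $$ (i, j) = ?Q $$ (i, j)" if ij: "i < n" "j < n" for i j
  proof -
    \<comment> \<open>All rows of a block have the same sum, so averaging over the
      \<open>ns i\<close> rows returns it.\<close>
    have "(\<Sum>k\<in>S i. \<Sum>l\<in>S j. M $$ (k, l)) = real (ns i) * (if i = j then q i else b i j * real (ns j))"
      using row[OF ij] card_S ij by simp
    then show ?thesis
      using ij Ps_nth length_Ps card_S ns[OF ij(1)] by (simp add: quotient_mat_def)
  qed
  then have Q: "quotient_mat M Ps = ?Q"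
    by (intro eq_matI) (auto simp: quotient_mat_def length_Ps)
  then show "quotient_mat M Ps = mat n n (\<lambda>(i, j).
      if i = j then \<alpha> * ((real (ns i) + real (r i) - 1) / 2 + m i) + (1 - \<alpha>) * n' i
      else (1 - \<alpha>) * real (ns j) / gdist G (vs ! i) (vs ! j))"
    by (simp add: q_def b_def cong: if_cong)

  \<comment> \<open>Factorisation of the characteristic polynomial\<close>
  have "?Q = mat n n (\<lambda>(i, j). if i = j then q i else b i j * of_nat (card {l. l < N \<and> c l = j}))"
    using card_S by (intro eq_matI) (auto simp: S_def)
  then have "char_poly M * (\<Prod>i<n. [:- q i, 1:])
      = char_poly ?Q * (\<Prod>i<n. char_poly (submatrix M (S i) (S i)))"
    using char_poly_times_prod_row_sums[OF M_carrier, of c n q b] hs_mem(1) row_diag M_off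
    by (simp add: S_def)
  then have "to_fract (char_poly M) * (\<Prod>i<n. to_fract [:- q i, 1:])
      = to_fract (char_poly ?Q) * (\<Prod>i<n. to_fract (char_poly (submatrix M (S i) (S i))))"
    by (simp only: to_fract_mult[symmetric] to_fract_prod[symmetric])
  \<comment> \<open>The factors \<open>[:- q i, 1:]\<close> are nonzero by their leading coefficient
    1, so their product can be divided off.\<close>
  then have "to_fract (char_poly M) = to_fract (char_poly ?Q)
      * (\<Prod>i<n. to_fract (char_poly (submatrix M (S i) (S i))) / to_fract [:- q i, 1:])"
    by (simp add: prod_dividef nonzero_eq_divide_eq)
  then show "to_fract (char_poly M) = to_fract (char_poly (quotient_mat M Ps)) *
      (\<Prod>i<n. to_fract (char_poly (submatrix M (Ps ! i) (Ps ! i))) /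
        to_fract [:- (\<alpha> * ((real (ns i) + real (r i) - 1) / 2 + m i) + (1 - \<alpha>) * n' i), 1:])"
    unfolding Q by (simp add: Ps_nth q_def)
qed

end
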